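(* Let $\mathcal{C}$ be a covariety and let $A$ be a $\mathcal{C}$-set. Then $\mathcal{C}(A)$, the intersection of all elements of $\mathcal{C}$ containing $A$, is the least (with respect to set inclusion) element of $\mathcal{C}$ containing $A$.
   Context: Let $\mathbb{N}=\{0,1,2,\dots\}$. A numerical semigroup is a subset $S\subseteq\mathbb{N}$ that contains $0$, is closed under addition, and has finite complement $\mathbb{N}\setminus S$. Its multiplicity is $m(S)=\min(S\setminus\{0\})$. A covariety is a nonempty family $\mathcal{C}$ of numerical semigroups such that: (1) $\mathcal{C}$ has a minimum $\Delta(\mathcal{C})=\min(\mathcal{C})$ with respect to set inclusion; (2) if $S,T\in\mathcal{C}$ then $S\cap T\in\mathcal{C}$; (3) if $S\in\mathcal{C}$ and $S\neq\Delta(\mathcal{C})$ then $S\setminus\{m(S)\}\in\mathcal{C}$. A $\mathcal{C}$-set is a subset of $M\setminus\Delta(\mathcal{C})$ for some maximal (with respect to inclusion) element $M$ of $\mathcal{C}$. *)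

theory Defs imports Main begin

definition numerical_semigroup :: "nat set \<Rightarrow> bool" where
  "numerical_semigroup S \<longleftrightarrow>
     0 \<in> S \<and> (\<forall>x\<in>S. \<forall>y\<in>S. x + y \<in> S) \<and> finite (UNIV - S)"

definition multiplicity :: "nat set \<Rightarrow> nat" where
  "multiplicity S = (LEAST x. x \<in> S - {0})"

definition is_minimum :: "nat set set \<Rightarrow> nat set \<Rightarrow> bool" where
  "is_minimum \<C> D \<longleftrightarrow> D \<in> \<C> \<and> (\<forall>S\<in>\<C>. D \<subseteq> S)"

text \<open>By antisymmetry of inclusion the minimum is unique if it exists, so the description
  below is well defined on every covariety.\<close>

definition minimum :: "nat set set \<Rightarrow> nat set" where
  "minimum \<C> = (THE D. is_minimum \<C> D)"

definition covariety :: "nat set set \<Rightarrow> bool" where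
  "covariety \<C> \<longleftrightarrow>
     \<C> \<noteq> {} \<and>
     (\<forall>S\<in>\<C>. numerical_semigroup S) \<and>
     (\<exists>D. is_minimum \<C> D) \<and>
     (\<forall>S\<in>\<C>. \<forall>T\<in>\<C>. S \<inter> T \<in> \<C>) \<and>
     (\<forall>S\<in>\<C>. S \<noteq> minimum \<C> \<longrightarrow> S - {multiplicity S} \<in> \<C>)"

definition is_maximal :: "nat set set \<Rightarrow> nat set \<Rightarrow> bool" where
  "is_maximal \<C> M \<longleftrightarrow> M \<in> \<C> \<and> (\<forall>S\<in>\<C>. M \<subseteq> S \<longrightarrow> S = M)"

definition C_set :: "nat set set \<Rightarrow> nat set \<Rightarrow> bool" where
  "C_set \<C> A \<longleftrightarrow> (\<exists>M. is_maximal \<C> M \<and> A \<subseteq> M - minimum \<C>)"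

definition generated :: "nat set set \<Rightarrow> nat set \<Rightarrow> nat set" where
  "generated \<C> A = \<Inter>{S \<in> \<C>. A \<subseteq> S}"

end

theory Submission imports Defs begin

text \<open>Every member of a covariety contains the minimum, whose complement is finite, so a covariety
  is a finite family. Hence the intersection defining the generated element is a finite one, and
  covarieties are closed under those.\<close>

text \<open>A superset of \<open>D\<close> is determined by its part outside \<open>D\<close>, and
  the finite set \<open>UNIV - D\<close> has only finitely many subsets.\<close>

lemma finite_supersets_of_cofinite:
  fixes D :: "'a set"
  assumes "finite (UNIV - D)"
  shows "finite {S. D \<subseteq> S}"
proof (rule finite_subset)
  show "{S. D \<subseteq> S} \<subseteq> (\<lambda>X. D \<union> X) ` Pow (UNIV - D)"
  proof
    fix S assume "S \<in> {S. D \<subseteq> S}"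
    then have "S = D \<union> (S - D)" by blast
    then show "S \<in> (\<lambda>X. D \<union> X) ` Pow (UNIV - D)" by blast
  qed
  show "finite ((\<lambda>X. D \<union> X) ` Pow (UNIV - D))"
    using assms by simp
qed

lemma covariety_finite:
  assumes "covariety \<C>"
  shows "finite \<C>"
proof -
  obtain D where D: "D \<in> \<C>" "\<forall>S\<in>\<C>. D \<subseteq> S"
    using assms unfolding covariety_def is_minimum_def by blast
  have "finite (UNIV - D)"
    using assms D(1) unfolding covariety_def numerical_semigroup_def by blast
  then show ?thesis
    by (rule finite_subset[OF _ finite_supersets_of_cofinite, rotated]) (use D(2) in blast)
qed

theorem proposition4p1:
  fixes \<C> :: "nat set set" and A :: "nat set"
  assumes "covariety \<C>" and "C_set \<C> A"
  shows "is_minimum {S \<in> \<C>. A \<subseteq> S} (generated \<C> A)"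
proof -
  let ?F = "{S \<in> \<C>. A \<subseteq> S}"
  \<comment> \<open>The witness is the maximal element of \<open>\<C>\<close> that
    \<open>C_set\<close> provides: it contains \<open>A\<close>.\<close>
  have "?F \<noteq> {}"
    using assms(2) unfolding C_set_def is_maximal_def by blast
  moreover have "finite ?F"
    using covariety_finite[OF assms(1)] by simp
  moreover have "S \<inter> T \<in> ?F" if "S \<in> ?F" "T \<in> ?F" for S T
    using assms(1) that unfolding covariety_def by blast
  \<comment> \<open>Nonemptiness matters: were \<open>?F\<close> empty, its intersection would be
    \<open>UNIV\<close>, which is not in it.\<close>
  ultimately have "\<Inter>?F \<in> ?F"
    by (intro finite_Inf_in) auto
  then show ?thesis
    unfolding is_minimum_def generated_def by blast
qed

end
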